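(* Let $X$ be a set and let $A,B$ be signed subsets of $X$, i.e. elements of $\mathscr S(X)$. Then $$A\circ B=A\mathbin{\hat{\ }}(\Delta B),$$ where $\Delta B=\Delta(1,B)$.
   Context: A signed subset of $X$ is a pair $A=\langle A^+,A^-\rangle$ of disjoint subsets of $X$; $\mathscr S(X)$ is the set of all of them. It carries the operations $1=\langle\emptyset,\emptyset\rangle$, $\langle A,B\rangle\vee\langle C,D\rangle=\langle A\cap C,B\cap D\rangle$ (so $Y\le Z$ iff $Z^+\subseteq Y^+$ and $Z^-\subseteq Y^-$), and $\Delta(\langle A,B\rangle,\langle C,D\rangle)=\langle A\cup(D\setminus B),\,B\cup(C\setminus A)\rangle$. The caret operation is $A\mathbin{\hat{\ }}B=A\wedge\Delta(A\vee B,B)$, where $\wedge$ is the greatest lower bound in $\mathscr S(X)$ (this meet always exists here). The composition of signed sets is $A\circ B=\langle A^+\cup(B^+\setminus A^-),\,A^-\cup(B^-\setminus A^+)\rangle$. *)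

theory Defs
  imports "HOL-Algebra.Lattice"
begin

type_synonym 'a sset = "'a set \<times> 'a set"

definition signed_sets :: "'a set \<Rightarrow> 'a sset set" where
  "signed_sets X = {(P, N). P \<subseteq> X \<and> N \<subseteq> X \<and> P \<inter> N = {}}"

definition sone :: "'a sset" where
  "sone = ({}, {})"

fun sjoin :: "'a sset \<Rightarrow> 'a sset \<Rightarrow> 'a sset" where
  "sjoin (A, B) (C, D) = (A \<inter> C, B \<inter> D)"

fun sDelta :: "'a sset \<Rightarrow> 'a sset \<Rightarrow> 'a sset" where
  "sDelta (A, B) (C, D) = (A \<union> (D - B), B \<union> (C - A))"

fun scompose :: "'a sset \<Rightarrow> 'a sset \<Rightarrow> 'a sset" where
  "scompose (A, B) (C, D) = (A \<union> (C - B), B \<union> (D - A))"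

text \<open>The order is reverse inclusion in both components, so that \<^const>\<open>sone\<close> is the top element.\<close>

definition sset_order :: "'a set \<Rightarrow> 'a sset gorder" where
  "sset_order X = \<lparr>carrier = signed_sets X, eq = (=),
     le = (\<lambda>Y Z. fst Z \<subseteq> fst Y \<and> snd Z \<subseteq> snd Y)\<rparr>"

text \<open>
  The order has no meets in general: \<open>({x}, {})\<close> and \<open>({}, {x})\<close> have no common lower bound.
  The particular meet used in the caret operation does exist, see \<open>caret_meet_exists\<close> below, so
  the value of the underlying choice operator is determined.
\<close>

definition caret :: "'a set \<Rightarrow> 'a sset \<Rightarrow> 'a sset \<Rightarrow> 'a sset" where
  "caret X A B = A \<sqinter>\<^bsub>sset_order X\<^esub> sDelta (sjoin A B) B"

lemma partial_order_sset_order: "partial_order (sset_order X)"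
  by unfold_locales (auto simp: sset_order_def)

lemma sjoin_is_lub:
  assumes "A \<in> signed_sets X" "B \<in> signed_sets X"
  shows "least (sset_order X) (sjoin A B) (Upper (sset_order X) {A, B})"
  using assms by (cases A; cases B) (auto simp: least_def Upper_def sset_order_def signed_sets_def)

lemma sDelta_closed:
  assumes "A \<in> signed_sets X" "B \<in> signed_sets X"
  shows "sDelta A B \<in> signed_sets X"
  using assms by (cases A; cases B) (auto simp: signed_sets_def)

lemma caret_meet_exists:
  assumes "A \<in> signed_sets X" "B \<in> signed_sets X"
  shows "\<exists>M. greatest (sset_order X) M (Lower (sset_order X) {A, sDelta (sjoin A B) B})"
proof -
  obtain P N where D: "sDelta (sjoin A B) B = (P, N)" by fastforce
  obtain A1 A2 where A: "A = (A1, A2)" by fastforce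
  have PN: "P \<subseteq> X" "N \<subseteq> X" "P \<inter> N = {}" "P \<inter> A2 = {}" "N \<inter> A1 = {}"
    using assms D A by (cases B; auto simp: signed_sets_def)+
  have "greatest (sset_order X) (A1 \<union> P, A2 \<union> N) (Lower (sset_order X) {A, (P, N)})"
    using assms(1) PN unfolding A greatest_def Lower_def sset_order_def signed_sets_def
    by (simp add: Int_Un_distrib Int_Un_distrib2 Int_commute)
  then show ?thesis unfolding D ..
qed

end

theory Submission
  imports Defs
begin

text \<open>With \<open>A = (P, N)\<close> and \<open>B = (R, S)\<close>,
  \<open>sDelta sone B\<close> is the sign swap \<open>(S, R)\<close>, so the caret is the meet of
  \<open>A\<close> with \<open>((P \<inter> S) \<union> (R - N), (N \<inter> R) \<union> (S -
  P))\<close>. The order is reverse inclusion, so a meet is the componentwise union when that is a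
  signed set (\<open>sset_greatest_Un\<close>). \<open>P\<close> and \<open>N\<close> absorb the
  intersections, and the composition remains.\<close>

text \<open>The meet is a choice among greatest lower bounds; antisymmetry leaves only one.\<close>

lemma sset_meet_eqI:
  assumes "greatest (sset_order X) M (Lower (sset_order X) {A, B})"
  shows "A \<sqinter>\<^bsub>sset_order X\<^esub> B = M"
proof -
  interpret partial_order "sset_order X"
    by (rule partial_order_sset_order)
  show ?thesis
    unfolding meet_def inf_def
    using assms by (blast intro: some_equality greatest_unique)
qed

text \<open>Lower bounds are the signed sets containing both pairs componentwise. Only disjointness
  can fail for the union, so it is assumed there and passes down to both pairs.\<close>

lemma sset_greatest_Un:
  assumes "(P \<union> R, N \<union> S) \<in> signed_sets X"
  shows "greatest (sset_order X) (P \<union> R, N \<union> S) (Lower (sset_order X) {(P, N), (R, S)})"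
proof -
  have "(P, N) \<in> signed_sets X" "(R, S) \<in> signed_sets X"
    using assms by (auto simp: signed_sets_def)
  with assms show ?thesis
    by (simp add: greatest_def Lower_def sset_order_def)
qed

theorem theorem4p2:
  fixes X :: "'a set" and A B :: "'a sset"
  assumes "A \<in> signed_sets X" and "B \<in> signed_sets X"
  shows "scompose A B = caret X A (sDelta sone B)"
proof -
  obtain P N where A: "A = (P, N)" by fastforce
  obtain R S where B: "B = (R, S)" by fastforce
  \<comment> \<open>The form that \<open>sDelta\<close> yields on the swapped pair
    \<open>(S, R)\<close>.\<close>
  define U V where "U = (P \<inter> S) \<union> (R - N \<inter> R)" and "V = (N \<inter> R) \<union> (S - P \<inter> S)"
  have Delta: "sDelta (sjoin A (sDelta sone B)) (sDelta sone B) = (U, V)"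
    by (simp add: A B sone_def U_def V_def)
  have comp: "scompose A B = (P \<union> U, N \<union> V)"
    by (auto simp: A B U_def V_def)
  \<comment> \<open>Disjoint: \<open>P \<inter> N\<close> and \<open>R \<inter> S\<close> are empty,
    and \<open>R - N\<close>, \<open>S - P\<close> drop the sign conflicts with
    \<open>A\<close>.\<close>
  have "(P \<union> U, N \<union> V) \<in> signed_sets X"
    using assms by (auto simp: A B U_def V_def signed_sets_def)
  then show ?thesis
    unfolding caret_def Delta comp unfolding A
    by (intro sset_meet_eqI[symmetric] sset_greatest_Un)
qed

end
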